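(* For every even integer $n\ge 2$, there exists a happy temporal graph with $N=3n$ vertices, exactly $\frac{n(n+9)}{2}-3$ edges, and all labels in $\{1,\dots,\frac{n(n+5)}{2}-1\}$, which is temporally connected, and such that removing any subset of $5n$ of its edges results in a temporal graph that is not temporally connected.
   Context: A temporal graph is a triple $\mathcal G=(V,E,\lambda)$ where $V$ is a finite vertex set, $E$ is a set of undirected edges on $V$, and $\lambda:E\to 2^{\mathbb N}\setminus\{\emptyset\}$ assigns to each edge a nonempty set of presence times. The footprint of $\mathcal G$ is the static graph $(V,E)$. A contact is a pair $(e,t)$ with $e\in E$ and $t\in\lambda(e)$. A journey from $u$ to $v$ is a sequence of contacts $(e_1,t_1),\dots,(e_k,t_k)$, $k\ge 1$, such that $e_1,\dots,e_k$ form a path from $u$ to $v$ in the footprint and $t_1\le t_2\le\dots\le t_k$. $\mathcal G$ is proper if $\lambda(e)\cap\lambda(e')=\emptyset$ for any two distinct edges $e,e'$ sharing an endpoint (so in a proper graph the times along any journey are strictly increasing); simple if $|\lambda(e)|=1$ for every edge $e$; happy if it is both proper and simple. $\mathcal G$ is temporally connected if for every ordered pair of distinct vertices $(u,v)$ there is a journey from $u$ to $v$. Removing an edge removes it together with all its labels. *)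

theory Defs
  imports Main
begin

definition temporal_graph :: "'a set \<Rightarrow> 'a set set \<Rightarrow> ('a set \<Rightarrow> nat set) \<Rightarrow> bool" where
  "temporal_graph V E lam \<longleftrightarrow> finite V \<and>
     (\<forall>e\<in>E. \<exists>u v. e = {u, v} \<and> u \<noteq> v \<and> u \<in> V \<and> v \<in> V) \<and>
     (\<forall>e\<in>E. lam e \<noteq> {})"

definition journey :: "'a set set \<Rightarrow> ('a set \<Rightarrow> nat set) \<Rightarrow> 'a \<Rightarrow> 'a \<Rightarrow> bool" where
  "journey E lam u v \<longleftrightarrow> (\<exists>vs ts.
     ts \<noteq> [] \<and> length vs = length ts + 1 \<and> hd vs = u \<and> last vs = v \<and> distinct vs \<and>
     (\<forall>i < length ts. {vs ! i, vs ! Suc i} \<in> E \<and> ts ! i \<in> lam {vs ! i, vs ! Suc i}) \<and>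
     sorted ts)"

definition temporally_connected :: "'a set \<Rightarrow> 'a set set \<Rightarrow> ('a set \<Rightarrow> nat set) \<Rightarrow> bool" where
  "temporally_connected V E lam \<longleftrightarrow>
     (\<forall>u\<in>V. \<forall>v\<in>V. u \<noteq> v \<longrightarrow> journey E lam u v)"

definition proper_tg :: "'a set set \<Rightarrow> ('a set \<Rightarrow> nat set) \<Rightarrow> bool" where
  "proper_tg E lam \<longleftrightarrow>
     (\<forall>e\<in>E. \<forall>e'\<in>E. e \<noteq> e' \<and> e \<inter> e' \<noteq> {} \<longrightarrow> lam e \<inter> lam e' = {})"

definition simple_tg :: "'a set set \<Rightarrow> ('a set \<Rightarrow> nat set) \<Rightarrow> bool" where
  "simple_tg E lam \<longleftrightarrow> (\<forall>e\<in>E. card (lam e) = 1)"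

definition happy_tg :: "'a set set \<Rightarrow> ('a set \<Rightarrow> nat set) \<Rightarrow> bool" where
  "happy_tg E lam \<longleftrightarrow> proper_tg E lam \<and> simple_tg E lam"

end

(*
  Let n = 2k. The complete graph on n vertices splits into k Hamiltonian paths. Label the i-th
  path increasingly within its own time window, the windows being consecutive, and let S i enter the
  start of path i when its window opens and T i be served by the end of path i when it closes: then
  S i reaches T i only along the whole path, so every clique edge is needed. The remaining
  10k - 3 < 5n edges make the graph temporally connected: the clique vertices 0 and k serve as an
  early and a late hub, and a third hub S (k - 1) carries the information of S i to T j for j < i.
  The latter must not leak back into the clique early, which is why S i enters through a
  vertex U i contacted before that hub, and T i is served through a vertex W i contacted after it.
*)

theory Submission
  imports Defs
begin

section \<open>Graphs given by oriented contacts\<close>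

text \<open>A path can be followed only in its own window, so \<open>S i\<close> comes too late for
  the paths j < i; supplying \<open>T j\<close> with its information is the one repair needed, and
  it is delicate because contacts work in both directions. The third hub meets the others in order
  of decreasing index, \<open>T i\<close> just before \<open>S i\<close>, so that it passes the
  information of \<open>S i\<close> on to \<open>T j\<close> for j < i but not to
  \<open>T i\<close>. In the same contacts it also passes it back to the \<open>S j\<close> with j <
  i. If \<open>S j\<close> were attached directly to the start of path j, or \<open>T j\<close> to
  its end, that information would be in the clique when window i opens, could board path i in the
  middle and so bypass its first edges. The detours over \<open>U j\<close> and \<open>W j\<close>
  close this leak, since \<open>S j\<close> meets \<open>U j\<close> before it learns anything and
  \<open>T j\<close> meets \<open>W j\<close> only after everything else.\<close>

definition adjacent :: "('a \<Rightarrow> 'a \<Rightarrow> nat \<Rightarrow> bool) \<Rightarrow> 'a \<Rightarrow> 'a \<Rightarrow> nat \<Rightarrow> bool" where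
  "adjacent A x y l \<longleftrightarrow> A x y l \<or> A y x l"

definition edges :: "('a \<Rightarrow> 'a \<Rightarrow> nat \<Rightarrow> bool) \<Rightarrow> 'a set set" where
  "edges A = {{x, y} | x y. \<exists>l. A x y l}"

definition labels :: "('a \<Rightarrow> 'a \<Rightarrow> nat \<Rightarrow> bool) \<Rightarrow> 'a set \<Rightarrow> nat set" where
  "labels A e = {l. \<exists>x y. e = {x, y} \<and> A x y l}"

lemma adjacent_sym: "adjacent A x y l \<longleftrightarrow> adjacent A y x l"
  by (auto simp: adjacent_def)

lemma labels_iff: "l \<in> labels A {x, y} \<longleftrightarrow> adjacent A x y l"
  by (auto simp: labels_def adjacent_def doubleton_eq_iff)

lemma edges_iff: "{x, y} \<in> edges A \<longleftrightarrow> (\<exists>l. adjacent A x y l)"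
  by (auto simp: edges_def adjacent_def doubleton_eq_iff)

lemma edgesE:
  assumes "e \<in> edges A"
  obtains x y l where "e = {x, y}" "A x y l"
  using assms by (auto simp: edges_def)

text \<open>The first assumption yields simplicity; the second, read at the common endpoint of two
  edges, yields properness.\<close>

lemma happy_edges:
  assumes "\<And>x y l l'. adjacent A x y l \<Longrightarrow> adjacent A x y l' \<Longrightarrow> l = l'"
    and "\<And>x y y' l. adjacent A x y l \<Longrightarrow> adjacent A x y' l \<Longrightarrow> y = y'"
  shows "happy_tg (edges A) (labels A)"
  unfolding happy_tg_def
proof
  show "proper_tg (edges A) (labels A)"
    unfolding proper_tg_def
  proof (intro ballI impI)
    fix e e' assume "e \<in> edges A" "e' \<in> edges A" and ne: "e \<noteq> e' \<and> e \<inter> e' \<noteq> {}"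
    then obtain z y y' where e: "e = {z, y}" "e' = {z, y'}"
      unfolding edges_def by blast
    with ne have "y \<noteq> y'" by auto
    then show "labels A e \<inter> labels A e' = {}"
      using assms(2) unfolding e by (auto simp: labels_iff)
  qed
  show "simple_tg (edges A) (labels A)"
    unfolding simple_tg_def
  proof
    fix e assume "e \<in> edges A"
    then obtain x y l where e: "e = {x, y}" "A x y l" by (rule edgesE)
    then have "adjacent A x y l" by (simp add: adjacent_def)
    then have "labels A e = {l}"
      using assms(1) unfolding e(1) by (auto simp: labels_iff)
    then show "card (labels A e) = 1" by simp
  qed
qed

lemma temporal_graph_edges:
  assumes "finite V" and "\<And>x y l. A x y l \<Longrightarrow> x \<in> V \<and> y \<in> V \<and> x \<noteq> y"
  shows "temporal_graph V (edges A) (labels A)"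
  unfolding temporal_graph_def
proof (intro conjI ballI assms(1))
  fix e assume "e \<in> edges A"
  then obtain x y l where e: "e = {x, y}" "A x y l" by (rule edgesE)
  then show "\<exists>u v. e = {u, v} \<and> u \<noteq> v \<and> u \<in> V \<and> v \<in> V" using assms(2) by blast
  show "labels A e \<noteq> {}" using e by (auto simp: labels_def)
qed

lemma card_edges:
  assumes "\<And>x y l l'. A x y l \<Longrightarrow> \<not> A y x l'"
  shows "card (edges A) = card {(x, y). \<exists>l. A x y l}"
proof -
  have "edges A = (\<lambda>(x, y). {x, y}) ` {(x, y). \<exists>l. A x y l}"
    by (auto simp: edges_def)
  moreover have "inj_on (\<lambda>(x, y). {x, y}) {(x, y). \<exists>l. A x y l}"
    using assms by (auto simp: inj_on_def doubleton_eq_iff)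
  ultimately show ?thesis by (simp add: card_image)
qed

section \<open>Journeys\<close>

text \<open>Differs from \<open>journey\<close> in two ways that suit induction: no contact at all
  is allowed, and \<open>c\<close> is a deadline rather than an arrival time, so that waiting
  amounts to enlarging \<open>c\<close>.\<close>

definition reach_by :: "('a \<Rightarrow> 'a \<Rightarrow> nat \<Rightarrow> bool) \<Rightarrow> 'a \<Rightarrow> 'a \<Rightarrow> nat \<Rightarrow> bool" where
  "reach_by A u v c \<longleftrightarrow> (\<exists>vs ts. length vs = length ts + 1 \<and> hd vs = u \<and> last vs = v \<and> distinct vs \<and>
     (\<forall>i < length ts. adjacent A (vs ! i) (vs ! Suc i) (ts ! i)) \<and> sorted ts \<and> (\<forall>t \<in> set ts. t \<le> c))"

lemma reach_by_refl: "reach_by A u u c"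
  unfolding reach_by_def by (intro exI[of _ "[u]"] exI[of _ "[]"]) simp

lemma reach_by_mono:
  assumes "reach_by A u v c" "c \<le> c'"
  shows "reach_by A u v c'"
proof -
  have "\<forall>t \<in> set ts. t \<le> c'" if "\<forall>t \<in> set ts. t \<le> c" for ts :: "nat list"
    using that assms(2) by auto
  then show ?thesis using assms(1) unfolding reach_by_def by blast
qed

text \<open>Journeys must not revisit a vertex. If \<open>w\<close> already occurs, the journey is
  cut at that occurrence; otherwise the contact is appended.\<close>

lemma reach_by_step:
  assumes "reach_by A u v c" and adj: "adjacent A v w l" and "c \<le> l"
  shows "reach_by A u w l"
proof -
  from assms(1) obtain vs ts where p: "length vs = length ts + 1" "hd vs = u" "last vs = v" "distinct vs"
    "\<forall>i < length ts. adjacent A (vs ! i) (vs ! Suc i) (ts ! i)" "sorted ts" "\<forall>t \<in> set ts. t \<le> c"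
    unfolding reach_by_def by blast
  from p(1) have ne: "vs \<noteq> []" by auto
  show ?thesis
  proof (cases "w \<in> set vs")
    case True
    then obtain j where j: "j < length vs" "vs ! j = w" by (auto simp: in_set_conv_nth)
    have "last (take (Suc j) vs) = w" using j by (simp add: take_Suc_conv_app_nth)
    moreover have "hd (take (Suc j) vs) = u" using p(2) by simp
    moreover have "\<forall>t \<in> set (take j ts). t \<le> l"
      using p(7) assms(3) by (meson in_set_takeD le_trans)
    ultimately show ?thesis
      unfolding reach_by_def using p(1,4,5,6) j
      by (intro exI[of _ "take (Suc j) vs"] exI[of _ "take j ts"]) simp
  next
    case False
    have nth: "adjacent A ((vs @ [w]) ! i) ((vs @ [w]) ! Suc i) ((ts @ [l]) ! i)"
      if i: "i < length (ts @ [l])" for i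
    proof (cases "i < length ts")
      case True
      then show ?thesis using p(1,5) by (auto simp: nth_append)
    next
      case False
      with i have "i = length ts" by simp
      then show ?thesis using p(1,3) adj ne by (simp add: nth_append last_conv_nth)
    qed
    have "sorted (ts @ [l])" using p(6,7) assms(3) by (auto simp: sorted_append)
    moreover have "\<forall>t \<in> set (ts @ [l]). t \<le> l" using p(7) assms(3) by auto
    moreover have "distinct (vs @ [w])" "hd (vs @ [w]) = u" using p(2,4) False ne by simp_all
    ultimately show ?thesis
      unfolding reach_by_def using p(1) nth
      by (intro exI[of _ "vs @ [w]"] exI[of _ "ts @ [l]"]) simp
  qed
qed

lemma reach_by_imp_journey:
  assumes "reach_by A u v c" "u \<noteq> v"
  shows "journey (edges A) (labels A) u v"
proof -
  from assms(1) obtain vs ts where p: "length vs = length ts + 1" "hd vs = u" "last vs = v" "distinct vs"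
    "\<forall>i < length ts. adjacent A (vs ! i) (vs ! Suc i) (ts ! i)" "sorted ts"
    unfolding reach_by_def by blast
  have "ts \<noteq> []"
  proof
    assume "ts = []"
    with p(1) obtain a where "vs = [a]" by (auto simp: length_Suc_conv)
    with p assms(2) show False by simp
  qed
  moreover have "{vs ! i, vs ! Suc i} \<in> edges A \<and> ts ! i \<in> labels A {vs ! i, vs ! Suc i}"
    if "i < length ts" for i using p(5) that by (auto simp: labels_iff edges_iff)
  ultimately show ?thesis
    unfolding journey_def using p by (intro exI[of _ vs] exI[of _ ts]) simp
qed

text \<open>Labels may repeat along a journey, but consecutive edges of a path are distinct and share an
  endpoint, so in a proper graph a step-invariant only has to survive strictly later contacts.\<close>

lemma journey_invariant:
  assumes "journey E lam u v" and "proper_tg E lam"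
    and pos: "\<And>e l. e \<in> E \<Longrightarrow> l \<in> lam e \<Longrightarrow> 0 < l"
    and init: "I u 0"
    and step: "\<And>x y t l. I x t \<Longrightarrow> {x, y} \<in> E \<Longrightarrow> l \<in> lam {x, y} \<Longrightarrow> t < l \<Longrightarrow> I y l"
  shows "\<exists>t. I v t"
proof -
  from assms(1) obtain vs ts where p: "length vs = length ts + 1" "hd vs = u" "last vs = v" "distinct vs"
    "\<forall>i < length ts. {vs ! i, vs ! Suc i} \<in> E \<and> ts ! i \<in> lam {vs ! i, vs ! Suc i}" "sorted ts"
    unfolding journey_def by blast
  from p(1) have ne: "vs \<noteq> []" by auto
  have "I (vs ! j) (if j = 0 then 0 else ts ! (j - 1))" if "j \<le> length ts" for j
    using that
  proof (induction j)
    case 0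
    then show ?case using p(2) ne init by (simp add: hd_conv_nth)
  next
    case (Suc j)
    then have e: "{vs ! j, vs ! Suc j} \<in> E" "ts ! j \<in> lam {vs ! j, vs ! Suc j}"
      using p(5)[rule_format, of j] by simp_all
    have "(if j = 0 then 0 else ts ! (j - 1)) < ts ! j"
    proof (cases "j = 0")
      case True
      then show ?thesis using pos[OF e] by simp
    next
      case False
      then obtain i where i: "j = Suc i" by (cases j) auto
      with Suc.prems have e': "{vs ! i, vs ! j} \<in> E" "ts ! i \<in> lam {vs ! i, vs ! j}"
        using p(5)[rule_format, of i] by simp_all
      have "vs ! i \<noteq> vs ! Suc j" "vs ! i \<noteq> vs ! j"
        using p(1,4) i Suc.prems by (simp_all add: nth_eq_iff_index_eq)
      then have "{vs ! i, vs ! j} \<noteq> {vs ! j, vs ! Suc j}" by (simp add: doubleton_eq_iff)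
      then have "lam {vs ! i, vs ! j} \<inter> lam {vs ! j, vs ! Suc j} = {}"
        using assms(2)[unfolded proper_tg_def, rule_format, OF e'(1) e(1)] by simp
      then have "ts ! i \<noteq> ts ! j" using e(2) e'(2) by auto
      moreover have "ts ! i \<le> ts ! j" using p(6) i Suc.prems by (intro sorted_nth_mono) simp_all
      ultimately show ?thesis using i by simp
    qed
    then show ?case using step[OF Suc.IH e] Suc.prems by simp
  qed
  from this[of "length ts"] have "I (vs ! length ts) (if length ts = 0 then 0 else ts ! (length ts - 1))"
    by simp
  moreover have "vs ! length ts = v" using p(1,3) ne by (simp add: last_conv_nth)
  ultimately show ?thesis by blast
qed

section \<open>Relabelling the vertices\<close>

lemma journey_image:
  assumes "inj f" "journey E lam u v"
  shows "journey ((`) f ` E) (lam \<circ> (`) (inv f)) (f u) (f v)"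
proof -
  from assms(2) obtain vs ts where p: "ts \<noteq> []" "length vs = length ts + 1" "hd vs = u" "last vs = v"
    "distinct vs" "sorted ts"
    "\<forall>i < length ts. {vs ! i, vs ! Suc i} \<in> E \<and> ts ! i \<in> lam {vs ! i, vs ! Suc i}"
    unfolding journey_def by blast
  have ne: "vs \<noteq> []" using p(2) by auto
  have "{map f vs ! i, map f vs ! Suc i} \<in> (`) f ` E \<and>
    ts ! i \<in> (lam \<circ> (`) (inv f)) {map f vs ! i, map f vs ! Suc i}" if "i < length ts" for i
  proof -
    have "{map f vs ! i, map f vs ! Suc i} = f ` {vs ! i, vs ! Suc i}" using that p(2) by simp
    then show ?thesis using p(7)[rule_format, OF that] assms(1) by (simp del: image_insert)
  qed
  moreover have "distinct (map f vs)"
    using p(5) assms(1) by (simp add: distinct_map inj_on_def)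
  moreover have "hd (map f vs) = f u" "last (map f vs) = f v"
    using p(3,4) ne by (simp_all add: hd_map last_map)
  ultimately show ?thesis
    unfolding journey_def using p(1,2,6)
    by (intro exI[of _ "map f vs"] exI[of _ ts]) simp
qed

lemma journey_image_iff:
  assumes "inj f"
  shows "journey ((`) f ` E) (lam \<circ> (`) (inv f)) (f u) (f v) \<longleftrightarrow> journey E lam u v"
proof
  assume "journey ((`) f ` E) (lam \<circ> (`) (inv f)) (f u) (f v)"
  then obtain vs ts where p: "ts \<noteq> []" "length vs = length ts + 1" "hd vs = f u" "last vs = f v"
    "distinct vs" "sorted ts"
    "\<forall>i < length ts. {vs ! i, vs ! Suc i} \<in> (`) f ` E \<and>
       ts ! i \<in> (lam \<circ> (`) (inv f)) {vs ! i, vs ! Suc i}"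
    unfolding journey_def by blast
  have ne: "vs \<noteq> []" using p(2) by auto
  \<comment> \<open>\<open>inv f\<close> undoes \<open>f\<close> only on its range. As
    \<open>ts\<close> is nonempty, every vertex of the journey lies on one of its edges, and these
    are images.\<close>
  have ran: "set vs \<subseteq> range f"
  proof
    fix x assume "x \<in> set vs"
    then obtain j where j: "j < length vs" "x = vs ! j" by (auto simp: in_set_conv_nth)
    obtain i where "i < length ts" "j = i \<or> j = Suc i"
    proof (cases j)
      case 0
      then show ?thesis using that[of 0] p(1) by simp
    next
      case (Suc i)
      then show ?thesis using that[of i] j p(2) by simp
    qed
    with p(7)[rule_format, of i] j obtain e where "f ` e = {vs ! i, vs ! Suc i}" by (metis imageE)
    then show "x \<in> range f" using j \<open>j = i \<or> j = Suc i\<close> by blast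
  qed
  have "{map (inv f) vs ! i, map (inv f) vs ! Suc i} \<in> E \<and>
    ts ! i \<in> lam {map (inv f) vs ! i, map (inv f) vs ! Suc i}" if "i < length ts" for i
  proof -
    have eq: "{map (inv f) vs ! i, map (inv f) vs ! Suc i} = inv f ` {vs ! i, vs ! Suc i}"
      using that p(2) by simp
    from p(7)[rule_format, OF that] obtain e where "{vs ! i, vs ! Suc i} = f ` e" "e \<in> E" by blast
    then show ?thesis using p(7)[rule_format, OF that] assms unfolding eq by simp
  qed
  moreover have "distinct (map (inv f) vs)"
    using p(5) ran by (auto simp: distinct_map intro: inj_on_subset[OF inj_on_inv_into])
  moreover have "hd (map (inv f) vs) = u" "last (map (inv f) vs) = v"
    using p(3,4) ne assms by (simp_all add: hd_map last_map)
  ultimately show "journey E lam u v"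
    unfolding journey_def using p
    by (intro exI[of _ "map (inv f) vs"] exI[of _ ts]) auto
qed (rule journey_image[OF assms])

lemma temporally_connected_image:
  assumes "inj f"
  shows "temporally_connected (f ` V) ((`) f ` E) (lam \<circ> (`) (inv f)) \<longleftrightarrow> temporally_connected V E lam"
  using assms by (auto simp: temporally_connected_def journey_image_iff inj_eq)

text \<open>The conclusion of the theorem with its numbers as parameters and over any vertex type,
  so that it can be proved on a convenient type and then transported to \<open>nat\<close>.\<close>

definition fragile_graph ::
    "nat \<Rightarrow> nat \<Rightarrow> nat \<Rightarrow> nat \<Rightarrow> 'a set \<Rightarrow> 'a set set \<Rightarrow> ('a set \<Rightarrow> nat set) \<Rightarrow> bool" where
  "fragile_graph N m t r V E lam \<longleftrightarrow>
     temporal_graph V E lam \<and> happy_tg E lam \<and> card V = N \<and> card E = m \<and>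
     (\<forall>e\<in>E. lam e \<subseteq> {1 .. t}) \<and> temporally_connected V E lam \<and>
     (\<forall>F \<subseteq> E. card F = r \<longrightarrow> \<not> temporally_connected V (E - F) lam)"

lemma fragile_graph_image:
  assumes "inj f" "fragile_graph N m t r V E lam"
  shows "fragile_graph N m t r (f ` V) ((`) f ` E) (lam \<circ> (`) (inv f))"
proof -
  have inj: "inj ((`) f)" using assms(1) by (simp add: inj_image_eq_iff inj_def)
  have cancel: "inv f ` f ` e = e" for e using assms(1) by simp
  have "\<not> temporally_connected (f ` V) ((`) f ` E - F) (lam \<circ> (`) (inv f))"
    if F: "F \<subseteq> (`) f ` E" "card F = r" for F
  proof -
    from F(1) obtain G where G: "G \<subseteq> E" "F = (`) f ` G" by (auto simp: subset_image_iff)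
    then have "card G = r" using F(2) inj by (metis card_image inj_on_subset subset_UNIV)
    moreover have "(`) f ` E - F = (`) f ` (E - G)" using G inj by (simp add: image_set_diff)
    ultimately show ?thesis
      using assms(2) G(1) unfolding fragile_graph_def
      by (simp add: temporally_connected_image[OF assms(1)])
  qed
  moreover have "temporal_graph (f ` V) ((`) f ` E) (lam \<circ> (`) (inv f))"
    unfolding temporal_graph_def
  proof (intro conjI ballI)
    show "finite (f ` V)" using assms(2) by (simp add: fragile_graph_def temporal_graph_def)
    fix e' assume "e' \<in> (`) f ` E"
    then obtain e where e: "e' = f ` e" "e \<in> E" by blast
    moreover have "\<forall>e\<in>E. \<exists>u v. e = {u, v} \<and> u \<noteq> v \<and> u \<in> V \<and> v \<in> V"
      using assms(2) by (simp add: fragile_graph_def temporal_graph_def)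
    ultimately obtain u v where "e = {u, v}" "u \<noteq> v" "u \<in> V" "v \<in> V" by blast
    then show "\<exists>u v. e' = {u, v} \<and> u \<noteq> v \<and> u \<in> f ` V \<and> v \<in> f ` V"
      using e(1) assms(1) by (intro exI[of _ "f u"] exI[of _ "f v"]) (simp add: inj_eq)
    show "(lam \<circ> (`) (inv f)) e' \<noteq> {}"
      using e assms(2) by (simp add: cancel fragile_graph_def temporal_graph_def)
  qed
  moreover have "happy_tg ((`) f ` E) (lam \<circ> (`) (inv f))"
    unfolding happy_tg_def
  proof
    have proper: "proper_tg E lam" and simple: "simple_tg E lam"
      using assms(2) by (simp_all add: fragile_graph_def happy_tg_def)
    show "proper_tg ((`) f ` E) (lam \<circ> (`) (inv f))"
      unfolding proper_tg_def
    proof (intro ballI impI)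
      fix e1 e2 assume "e1 \<in> (`) f ` E" "e2 \<in> (`) f ` E" and ne: "e1 \<noteq> e2 \<and> e1 \<inter> e2 \<noteq> {}"
      then obtain d1 d2 where d: "e1 = f ` d1" "e2 = f ` d2" "d1 \<in> E" "d2 \<in> E" by blast
      with ne have "d1 \<noteq> d2" "d1 \<inter> d2 \<noteq> {}" by (auto simp: image_Int[OF assms(1), symmetric])
      then show "(lam \<circ> (`) (inv f)) e1 \<inter> (lam \<circ> (`) (inv f)) e2 = {}"
        using proper d by (simp add: cancel proper_tg_def)
    qed
    show "simple_tg ((`) f ` E) (lam \<circ> (`) (inv f))"
      using simple by (simp add: simple_tg_def cancel)
  qed
  moreover have "card (f ` V) = N" "card ((`) f ` E) = m"
    using assms(2) card_image[OF inj_on_subset[OF assms(1) subset_UNIV]]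
      card_image[OF inj_on_subset[OF inj subset_UNIV]] by (simp_all add: fragile_graph_def)
  moreover have "\<forall>e\<in>(`) f ` E. (lam \<circ> (`) (inv f)) e \<subseteq> {1 .. t}"
    using assms(2) by (auto simp: cancel fragile_graph_def)
  moreover have "temporally_connected (f ` V) ((`) f ` E) (lam \<circ> (`) (inv f))"
    using assms by (simp add: temporally_connected_image fragile_graph_def)
  ultimately show ?thesis unfolding fragile_graph_def by blast
qed


section \<open>The zigzag decomposition of a complete graph into Hamiltonian paths\<close>

text \<open>The complete graph on \<open>{..<2k}\<close> splits into \<open>k\<close> Hamiltonian paths; path \<open>i\<close> visits
  \<open>i, i-1, i+1, i-2, \<dots>, i+k\<close> modulo \<open>2k\<close>, so that the sums of its consecutive vertices
  alternate between \<open>2i-1\<close> and \<open>2i\<close>.\<close>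

definition path_pos :: "nat \<Rightarrow> nat \<Rightarrow> nat \<Rightarrow> nat" where
  "path_pos k i x = (if x < i then 2 * (i - x) - 1 else if x < i + k then 2 * (x - i)
     else 2 * (2 * k + i - x) - 1)"

text \<open>On path i the sum x + y is 2i - 1 or 2i modulo 2k, so half the sum, rounded up, is i or
  i + k.\<close>

definition path_index :: "nat \<Rightarrow> nat \<Rightarrow> nat \<Rightarrow> nat" where
  "path_index k x y = (if (x + y + 1) div 2 < k then (x + y + 1) div 2 else (x + y + 1) div 2 - k)"

lemma path_index_commute: "path_index k x y = path_index k y x"
  by (simp add: path_index_def add.commute)

lemma path_index_less: "x < 2 * k \<Longrightarrow> y < 2 * k \<Longrightarrow> x \<noteq> y \<Longrightarrow> path_index k x y < k"
  unfolding path_index_def by (split if_split) linarith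

lemma path_pos_less: "i < k \<Longrightarrow> x < 2 * k \<Longrightarrow> path_pos k i x < 2 * k"
  unfolding path_pos_def by auto

lemma path_pos_start [simp]: "i < k \<Longrightarrow> path_pos k i i = 0"
  by (simp add: path_pos_def)

lemma path_pos_end [simp]: "i < k \<Longrightarrow> path_pos k i (i + k) = 2 * k - 1"
  by (simp add: path_pos_def)

text \<open>Subtraction-free form for linear arithmetic. The even positions hold the vertices from i
  to i + k - 1, the odd ones those behind the start, split in two by the wrap-around modulo
  2k.\<close>

lemma path_pos_cases:
  assumes "x < 2 * k"
  shows "x < i \<and> path_pos k i x + 2 * x + 1 = 2 * i \<and> odd (path_pos k i x) \<or>
    i \<le> x \<and> x < i + k \<and> path_pos k i x + 2 * i = 2 * x \<and> even (path_pos k i x) \<or>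
    i + k \<le> x \<and> path_pos k i x + 2 * x + 1 = 4 * k + 2 * i \<and> odd (path_pos k i x)"
proof -
  consider "x < i" | "i \<le> x" "x < i + k" | "i + k \<le> x" "i \<le> x" by linarith
  then show ?thesis
    by cases (use assms in \<open>auto simp: path_pos_def\<close>)
qed

lemma path_pos_inject:
  assumes "i < k" "x < 2 * k" "y < 2 * k" "path_pos k i x = path_pos k i y"
  shows "x = y"
  using path_pos_cases[OF assms(2), of i] path_pos_cases[OF assms(3), of i] assms(1-3)
  unfolding assms(4) by (elim disjE conjE) (erule (1) notE | linarith)+

text \<open>Together with \<open>path_index_eqI\<close> this is the decomposition property: each
  edge of the complete graph is a step of exactly one path.\<close>

lemma path_pos_path_index:
  assumes "x < 2 * k" "y < 2 * k" "x \<noteq> y" "i = path_index k x y"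
  shows "path_pos k i y = Suc (path_pos k i x) \<or> path_pos k i x = Suc (path_pos k i y)"
proof -
  define m where "m = (x + y + 1) div 2"
  have "2 * m = x + y \<or> 2 * m = x + y + 1" unfolding m_def by presburger
  moreover have "m < k \<and> i = m \<or> k \<le> m \<and> m = i + k"
    using assms(4) by (auto simp: m_def path_index_def)
  ultimately show ?thesis
    using path_pos_cases[OF assms(1), of i] path_pos_cases[OF assms(2), of i] assms(1-3)
    by (elim disjE conjE) linarith+
qed

lemma path_index_eqI:
  assumes "x < 2 * k" "y < 2 * k" "i < k" "path_pos k i y = Suc (path_pos k i x)"
  shows "path_index k x y = i"
proof -
  have parity: "even (path_pos k i y) \<longleftrightarrow> odd (path_pos k i x)"
    unfolding assms(4) by simp
  have "2 * i \<le> x + y + 1 \<and> x + y \<le> 2 * i \<or> 2 * i + 2 * k \<le> x + y + 1 \<and> x + y \<le> 2 * i + 2 * k"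
    using path_pos_cases[OF assms(1), of i]
      path_pos_cases[OF assms(2), of i, unfolded parity not_not, unfolded assms(4)] assms(1-3)
    by (elim disjE conjE) (erule (1) notE | linarith)+
  then have "(x + y + 1) div 2 = i \<or> (x + y + 1) div 2 = i + k" by linarith
  then show ?thesis using assms(3) unfolding path_index_def by (elim disjE) simp_all
qed

lemma path_pos_surj:
  assumes "i < k" "q < 2 * k"
  obtains x where "x < 2 * k" "path_pos k i x = q"
proof -
  have "inj_on (path_pos k i) {..<2 * k}"
    using assms(1) by (auto intro!: inj_onI dest: path_pos_inject)
  moreover have "path_pos k i ` {..<2 * k} \<subseteq> {..<2 * k}"
    using assms(1) by (auto simp: path_pos_less)
  ultimately have "path_pos k i ` {..<2 * k} = {..<2 * k}"
    by (intro endo_inj_surj) auto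
  then show ?thesis using assms(2) that by (metis (no_types, lifting) imageE lessThan_iff)
qed

section \<open>The construction\<close>

datatype vertex = H nat | S nat | T nat | U nat | W nat

text \<open>The window of path \<open>i\<close> opens at label \<open>win k i\<close> and closes at \<open>win k (i + 1)\<close>; labels up to
  \<open>2k\<close> are early, labels above \<open>win k k\<close> late. Consecutive windows share an end label.\<close>

definition win :: "nat \<Rightarrow> nat \<Rightarrow> nat" where
  "win k i = 2 * k + 1 + 2 * k * i"

text \<open>The larger position is that of the endpoint entered when the path is followed from its
  start. The offsets 1, ..., 2k - 1 leave both ends of the window to the contacts with
  \<open>U i\<close> and \<open>W i\<close>.\<close>

definition clique_label :: "nat \<Rightarrow> nat \<Rightarrow> nat \<Rightarrow> nat" where
  "clique_label k x y = win k (path_index k x y) +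
     max (path_pos k (path_index k x y) x) (path_pos k (path_index k x y) y)"

text \<open>As a hub, \<open>H 0\<close> uses the labels 1, ..., 2k and \<open>H k\<close> the 2k
  labels after \<open>win k k\<close>. The labels 4k - 2 - 2i and 4k - 1 - 2i of the third hub
  exceed 2k, so what \<open>T i\<close> learns there cannot go on to \<open>H 0\<close>.
  \<open>S 0\<close> has no contact with this hub because no path precedes path 0.\<close>

fun arc :: "nat \<Rightarrow> vertex \<Rightarrow> vertex \<Rightarrow> nat \<Rightarrow> bool" where
  "arc k (H x) (H y) l \<longleftrightarrow> x < y \<and> y < 2 * k \<and> l = clique_label k x y"
| "arc k (H x) (S i) l \<longleftrightarrow> i < k \<and> x = k \<and> l = win k k + 1 + i"
| "arc k (H x) (T i) l \<longleftrightarrow> i < k \<and> x = 0 \<and> l = i + 1"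
| "arc k (H x) (U i) l \<longleftrightarrow> i < k \<and> (x = i \<and> l = win k i \<or> x = k \<and> l = win k k + 1 + k + i)"
| "arc k (H x) (W i) l \<longleftrightarrow> i < k \<and> (x = 0 \<and> l = k + i + 1 \<or> x = i + k \<and> l = win k (Suc i))"
| "arc k (S i) (S c) l \<longleftrightarrow> Suc c = k \<and> 1 \<le> i \<and> i < c \<and> l = 4 * k - 1 - 2 * i"
| "arc k (S c) (T i) l \<longleftrightarrow> Suc c = k \<and> i < c \<and> l = 4 * k - 2 - 2 * i"
| "arc k (S i) (U j) l \<longleftrightarrow> i < k \<and> j = i \<and> l = 1"
| "arc k (T i) (W j) l \<longleftrightarrow> i < k \<and> j = i \<and> l = win k k + 2 * k"
| "arc k _ _ l \<longleftrightarrow> False"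

definition vertices :: "nat \<Rightarrow> vertex set" where
  "vertices k = H ` {..<2 * k} \<union> S ` {..<k} \<union> T ` {..<k} \<union> U ` {..<k} \<union> W ` {..<k}"

lemma win_Suc: "win k (Suc i) = win k i + 2 * k"
  by (simp add: win_def)

lemma win_0: "win k 0 = 2 * k + 1"
  by (simp add: win_def)

lemma win_mono: "i \<le> j \<Longrightarrow> win k i \<le> win k j"
  by (simp add: win_def)

lemma win_gap: "i < j \<Longrightarrow> win k i + 2 * k \<le> win k j"
  using win_mono[of "Suc i" j k] by (simp add: win_Suc)

lemma win_add_inject:
  assumes "win k i + p = win k j + q" "p < 2 * k" "q < 2 * k"
  shows "i = j \<and> p = q"
  using assms win_gap[of i j k] win_gap[of j i k] by (cases i j rule: linorder_cases) auto

lemma win_ge: "2 * k < win k i"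
  by (simp add: win_def)

lemma win_k_ge: "1 \<le> k \<Longrightarrow> 4 * k < win k k"
  using win_gap[of 0 k k] by (simp add: win_0)

lemma arc_in_vertices:
  assumes "2 \<le> k" "arc k x y l"
  shows "x \<in> vertices k \<and> y \<in> vertices k \<and> x \<noteq> y"
  using assms by (cases "(k, x, y, l)" rule: arc.cases) (auto simp: vertices_def)

lemma arc_asym: "arc k x y l \<Longrightarrow> \<not> arc k y x l'"
  by (cases "(k, x, y, l)" rule: arc.cases) auto

lemma finite_vertices: "finite (vertices k)"
  by (simp add: vertices_def)

lemma card_vertices: "card (vertices k) = 6 * k"
proof -
  have card: "card (f ` {..<m}) = m" if "inj f" for f :: "nat \<Rightarrow> vertex" and m
    using that by (simp add: card_image inj_on_subset)
  have inj: "inj H" "inj S" "inj T" "inj U" "inj W" by (simp_all add: inj_def)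
  have "card (H ` {..<2 * k} \<union> S ` {..<k}) = 3 * k"
    by (subst card_Un_disjoint) (auto simp: card inj)
  then have "card (H ` {..<2 * k} \<union> S ` {..<k} \<union> T ` {..<k}) = 4 * k"
    by (subst card_Un_disjoint) (auto simp: card inj)
  then have "card (H ` {..<2 * k} \<union> S ` {..<k} \<union> T ` {..<k} \<union> U ` {..<k}) = 5 * k"
    by (subst card_Un_disjoint) (auto simp: card inj)
  then show ?thesis
    unfolding vertices_def by (subst card_Un_disjoint) (auto simp: card inj)
qed

section \<open>Properness: distinct labels at each vertex\<close>

lemma clique_labelE:
  assumes "x < 2 * k" "y < 2 * k" "x \<noteq> y"
  obtains i p where "i < k" "i = path_index k x y" "0 < p" "p < 2 * k" "clique_label k x y = win k i + p"
    "p = max (path_pos k i x) (path_pos k i y)"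
proof
  show i: "path_index k x y < k" using assms by (rule path_index_less)
  show "0 < max (path_pos k (path_index k x y) x) (path_pos k (path_index k x y) y)"
    using path_pos_path_index[OF assms refl] by auto
  show "max (path_pos k (path_index k x y) x) (path_pos k (path_index k x y) y) < 2 * k"
    using path_pos_less[OF i] assms by simp
qed (simp_all add: clique_label_def)

lemma clique_label_commute: "clique_label k x y = clique_label k y x"
  by (simp add: clique_label_def path_index_commute max.commute)

lemma clique_label_bounds:
  assumes "x < 2 * k" "y < 2 * k" "x \<noteq> y"
  shows "2 * k < clique_label k x y" "clique_label k x y < win k k" "clique_label k x y \<noteq> win k j"
proof -
  from assms obtain i p where *: "i < k" "0 < p" "p < 2 * k" "clique_label k x y = win k i + p"
    by (rule clique_labelE)
  then show "2 * k < clique_label k x y" "clique_label k x y < win k k"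
    using win_ge[of k i] win_gap[of i k k] by auto
  show "clique_label k x y \<noteq> win k j" using * win_add_inject[of k i p j 0] by auto
qed

text \<open>A label determines its window and offset, so both edges belong to the same step of the
  same path, and the two path edges at a vertex are different steps.\<close>

lemma clique_label_inject:
  assumes "x < 2 * k" "y < 2 * k" "z < 2 * k" "x \<noteq> y" "x \<noteq> z"
    and eq: "clique_label k x y = clique_label k x z"
  shows "y = z"
proof -
  from assms(1,2,4) obtain i p where i: "i < k" "i = path_index k x y" "p < 2 * k"
    "clique_label k x y = win k i + p" "p = max (path_pos k i x) (path_pos k i y)"
    by (rule clique_labelE)
  from assms(1,3,5) obtain j q where j: "j = path_index k x z" "q < 2 * k"
    "clique_label k x z = win k j + q" "q = max (path_pos k j x) (path_pos k j z)"
    by (rule clique_labelE)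
  have ij: "i = j" "p = q" using win_add_inject[of k i p j q] eq i j by auto
  have "path_pos k i y = path_pos k i z"
    using path_pos_path_index[OF assms(1,2,4) i(2)] path_pos_path_index[OF assms(1,3,5) j(1)]
      ij i(5) j(4) by (auto simp: max_def split: if_splits)
  then show ?thesis by (rule path_pos_inject[OF i(1) assms(2,3)])
qed

lemma arc_bounds:
  assumes "2 \<le> k" "arc k x y l"
  shows "1 \<le> l \<and> l \<le> win k k + 2 * k"
proof -
  have "4 * k < win k k" using assms(1) by (simp add: win_k_ge)
  moreover have "win k i \<le> win k k" "win k (Suc i) \<le> win k k" if "i < k" for i
    using that by (simp_all add: win_mono)
  moreover have "1 \<le> win k i" for i by (simp add: win_def)
  moreover have "1 \<le> clique_label k a b \<and> clique_label k a b \<le> win k k + 2 * k" if "a < b" "b < 2 * k" for a b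
    using that clique_label_bounds(1,2)[of a k b] by simp
  ultimately show ?thesis
    using assms by (cases "(k, x, y, l)" rule: arc.cases) (auto intro: trans_le_add1)
qed

lemma arc_functional: "2 \<le> k \<Longrightarrow> arc k x y l \<Longrightarrow> arc k x y l' \<Longrightarrow> l = l'"
  by (cases "(k, x, y, l)" rule: arc.cases) auto

lemma adjacent_functional: "2 \<le> k \<Longrightarrow> adjacent (arc k) x y l \<Longrightarrow> adjacent (arc k) x y l' \<Longrightarrow> l = l'"
  unfolding adjacent_def using arc_functional arc_asym by blast

lemma adjacent_HH:
  "adjacent (arc k) (H x) (H y) l \<longleftrightarrow> x \<noteq> y \<and> x < 2 * k \<and> y < 2 * k \<and> l = clique_label k x y"
  by (auto simp: adjacent_def clique_label_commute)

lemma adjacent_inject_H: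
  assumes "2 \<le> k" "adjacent (arc k) (H x) y l" "adjacent (arc k) (H x) y' l"
  shows "y = y'"
proof -
  \<comment> \<open>The range of the label tells the disjuncts apart, except for the contacts with
    \<open>U\<close> and \<open>W\<close> at the ends of windows. There the vertex decides: it is
    the start of path x if x < k, and otherwise the end of path x - k.\<close>
  have cls: "(\<exists>i<k. y = T i \<and> l = i + 1 \<and> l \<le> k) \<or> (\<exists>i<k. y = W i \<and> l = k + i + 1 \<and> k < l \<and> l \<le> 2 * k) \<or>
    (y = U x \<and> x < k \<and> l \<in> range (win k) \<and> 2 * k < l \<and> l \<le> win k k) \<or>
    (\<exists>i. y = W i \<and> x = i + k \<and> l \<in> range (win k) \<and> 2 * k < l \<and> l \<le> win k k) \<or>
    (\<exists>z. y = H z \<and> z \<noteq> x \<and> z < 2 * k \<and> x < 2 * k \<and> l = clique_label k x z \<and>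
       l \<notin> range (win k) \<and> 2 * k < l \<and> l < win k k) \<or>
    (\<exists>i. y = S i \<and> l = win k k + 1 + i \<and> win k k < l \<and> l \<le> win k k + k) \<or>
    (\<exists>i. y = U i \<and> l = win k k + 1 + k + i \<and> win k k + k < l)"
    if "adjacent (arc k) (H x) y l" for y
  proof (cases y)
    case (H z)
    with that show ?thesis
      by (auto simp: adjacent_HH clique_label_bounds)
  qed (use that win_ge[of k] win_mono[of _ k k] in \<open>auto simp: adjacent_def\<close>)
  from cls[OF assms(2)] cls[OF assms(3)] win_ge[of k k] show ?thesis
    by (elim disjE exE conjE) (simp_all, metis clique_label_inject)
qed

text \<open>Parities are recorded because the labels of the hub \<open>S (k - 1)\<close> towards
  \<open>T j\<close> and towards \<open>S j\<close> interleave.\<close>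

lemma adjacent_S_cases:
  assumes "2 \<le> k" "adjacent (arc k) (S i) y l"
  shows "i < k \<and> (y = U i \<and> l = 1 \<or> y = H k \<and> l = win k k + 1 + i \<or>
    (\<exists>j<i. Suc i = k \<and> (y = T j \<and> even l \<and> l + 2 * j + 2 = 4 * k \<or> 1 \<le> j \<and> y = S j \<and> odd l \<and> l + 2 * j + 1 = 4 * k)) \<or>
    (Suc i < k \<and> 1 \<le> i \<and> y = S (k - 1) \<and> l + 2 * i + 1 = 4 * k))"
  using assms by (cases y) (auto simp: adjacent_def)

lemma adjacent_T_cases:
  assumes "2 \<le> k" "adjacent (arc k) (T i) y l"
  shows "i < k \<and> (y = H 0 \<and> l = i + 1 \<or> y = S (k - 1) \<and> Suc i < k \<and> l + 2 * i + 2 = 4 * k \<or>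
    y = W i \<and> l = win k k + 2 * k)"
  using assms by (cases y) (auto simp: adjacent_def)

lemma adjacent_U_cases:
  assumes "adjacent (arc k) (U i) y l"
  shows "i < k \<and> (y = S i \<and> l = 1 \<or> y = H i \<and> l = win k i \<or> y = H k \<and> l = win k k + 1 + k + i)"
  using assms by (cases y) (auto simp: adjacent_def)

lemma adjacent_W_cases:
  assumes "adjacent (arc k) (W i) y l"
  shows "i < k \<and> (y = H 0 \<and> l = k + i + 1 \<or> y = H (i + k) \<and> l = win k (Suc i) \<or>
    y = T i \<and> l = win k k + 2 * k)"
  using assms by (cases y) (auto simp: adjacent_def)

lemma adjacent_inject:
  assumes "2 \<le> k" "adjacent (arc k) x y l" "adjacent (arc k) x y' l"
  shows "y = y'"
proof (cases x)
  case (H a)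
  then show ?thesis using assms adjacent_inject_H by simp
next
  case (S i)
  have "4 * k < win k k" using assms(1) by (simp add: win_k_ge)
  with adjacent_S_cases[OF assms(1) assms(2)[unfolded S]] adjacent_S_cases[OF assms(1) assms(3)[unfolded S]]
  show ?thesis by (elim disjE exE conjE) simp_all
next
  case (T i)
  have "4 * k < win k k" using assms(1) by (simp add: win_k_ge)
  with adjacent_T_cases[OF assms(1) assms(2)[unfolded T]] adjacent_T_cases[OF assms(1) assms(3)[unfolded T]]
  show ?thesis by (elim disjE exE conjE) simp_all
next
  case (U i)
  have "2 * k < win k i" by (rule win_ge)
  moreover have "i < k \<longrightarrow> win k i \<le> win k k" by (simp add: win_mono)
  ultimately show ?thesis
    using adjacent_U_cases[OF assms(2)[unfolded U]] adjacent_U_cases[OF assms(3)[unfolded U]]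
    by (elim disjE exE conjE) simp_all
next
  case (W i)
  have "2 * k < win k (Suc i)" by (rule win_ge)
  moreover have "i < k \<longrightarrow> win k (Suc i) \<le> win k k" by (simp add: win_mono)
  ultimately show ?thesis
    using adjacent_W_cases[OF assms(2)[unfolded W]] adjacent_W_cases[OF assms(3)[unfolded W]]
    by (elim disjE exE conjE) simp_all
qed


subsection \<open>Counting the edges\<close>

definition other_pairs :: "nat \<Rightarrow> (vertex \<times> vertex) set" where
  "other_pairs k = {(x, y). (\<exists>l. arc k x y l) \<and> \<not> (\<exists>a b. x = H a \<and> y = H b)}"

lemma card_clique_pairs:
  "card {(x, y). (\<exists>l. arc k x y l) \<and> (\<exists>a b. x = H a \<and> y = H b)} = k * (2 * k - 1)"
proof -
  have "{(x, y). (\<exists>l. arc k x y l) \<and> (\<exists>a b. x = H a \<and> y = H b)} =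
      (\<lambda>(b, a). (H a, H b)) ` (SIGMA b:{..<2 * k}. {..<b})"
    by auto
  moreover have "inj_on (\<lambda>(b, a). (H a, H b)) (SIGMA b:{..<2 * k}. {..<b})"
    by (auto simp: inj_on_def)
  ultimately have "card {(x, y). (\<exists>l. arc k x y l) \<and> (\<exists>a b. x = H a \<and> y = H b)} = (\<Sum>b<2 * k. b)"
    by (simp add: card_image)
  also have "\<dots> = k * (2 * k - 1)"
  proof (induction k)
    case (Suc k)
    then show ?case by (cases k) (simp_all add: algebra_simps)
  qed simp
  finally show ?thesis .
qed

text \<open>Eight families of k edges, k - 1 edges from the third hub to the \<open>T i\<close>, and
  k - 2 from the \<open>S i\<close> to that hub, whose index is c.\<close>

lemma card_other_pairs:
  assumes "2 \<le> k"
  shows "card (other_pairs k) = 10 * k - 3"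
proof -
  define c where "c = k - 1"
  have k: "k = Suc c" "1 \<le> c" using assms by (simp_all add: c_def)
  let ?A1 = "(\<lambda>i. (H 0, T i)) ` {..<k}" and ?A2 = "(\<lambda>i. (H 0, W i)) ` {..<k}"
  let ?A3 = "(\<lambda>i. (H (i + k), W i)) ` {..<k}" and ?A4 = "(\<lambda>i. (H i, U i)) ` {..<k}"
  let ?A5 = "(\<lambda>i. (H k, U i)) ` {..<k}" and ?A6 = "(\<lambda>i. (H k, S i)) ` {..<k}"
  let ?A7 = "(\<lambda>i. (S i, U i)) ` {..<k}" and ?A8 = "(\<lambda>i. (T i, W i)) ` {..<k}"
  let ?A9 = "(\<lambda>i. (S c, T i)) ` {..<c}" and ?A10 = "(\<lambda>i. (S i, S c)) ` {1..<c}"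
  let ?As = "[?A1, ?A2, ?A3, ?A4, ?A5, ?A6, ?A7, ?A8, ?A9, ?A10]"
  have "other_pairs k \<subseteq> \<Union> (set ?As)"
  proof
    fix q assume "q \<in> other_pairs k"
    then obtain x y l where q: "q = (x, y)" and a: "arc k x y l" "\<not> (\<exists>a b. x = H a \<and> y = H b)"
      unfolding other_pairs_def by blast
    from a show "q \<in> \<Union> (set ?As)"
      unfolding q using k by (cases "(k, x, y, l)" rule: arc.cases) auto
  qed
  moreover have "\<Union> (set ?As) \<subseteq> other_pairs k"
    using k by (auto simp: other_pairs_def)
  ultimately have "other_pairs k = \<Union> (set ?As)" by (rule antisym)
  also have "card \<dots> = 10 * k - 3"
  proof -
    have inj: "inj (\<lambda>i. (H 0, T i))" "inj (\<lambda>i. (H 0, W i))" "inj (\<lambda>i. (H (i + m), W i))"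
      "inj (\<lambda>i. (H i, U i))" "inj (\<lambda>i. (H m, U i))" "inj (\<lambda>i. (H m, S i))" "inj (\<lambda>i. (S i, U i))"
      "inj (\<lambda>i. (T i, W i))" "inj (\<lambda>i. (S m, T i))" "inj (\<lambda>i. (S i, S m))" for m
      by (simp_all add: inj_def)
    have card: "card (f ` M) = card M" if "inj f" for f :: "nat \<Rightarrow> vertex \<times> vertex" and M
      using that by (simp add: card_image inj_on_subset)
    have "card (?A9 \<union> ?A10) = 2 * c - 1"
      by (subst card_Un_disjoint) (use k in \<open>auto simp: card inj simp del: add_Suc_right\<close>)
    then have "card (?A8 \<union> (?A9 \<union> ?A10)) = 3 * c"
      by (subst card_Un_disjoint) (use k in \<open>auto simp: card inj simp del: add_Suc_right\<close>)
    then have "card (?A7 \<union> (?A8 \<union> (?A9 \<union> ?A10))) = 4 * c + 1"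
      by (subst card_Un_disjoint) (use k in \<open>auto simp: card inj simp del: add_Suc_right\<close>)
    then have "card (?A6 \<union> (?A7 \<union> (?A8 \<union> (?A9 \<union> ?A10)))) = 5 * c + 2"
      by (subst card_Un_disjoint) (use k in \<open>auto simp: card inj simp del: add_Suc_right\<close>)
    then have "card (?A5 \<union> (?A6 \<union> (?A7 \<union> (?A8 \<union> (?A9 \<union> ?A10))))) = 6 * c + 3"
      by (subst card_Un_disjoint) (use k in \<open>auto simp: card inj simp del: add_Suc_right\<close>)
    then have "card (?A4 \<union> (?A5 \<union> (?A6 \<union> (?A7 \<union> (?A8 \<union> (?A9 \<union> ?A10)))))) = 7 * c + 4"
      by (subst card_Un_disjoint) (use k in \<open>auto simp: card inj simp del: add_Suc_right\<close>)
    then have "card (?A3 \<union> (?A4 \<union> (?A5 \<union> (?A6 \<union> (?A7 \<union> (?A8 \<union> (?A9 \<union> ?A10))))))) = 8 * c + 5"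
      by (subst card_Un_disjoint) (use k in \<open>auto simp: card inj simp del: add_Suc_right\<close>)
    then have "card (?A2 \<union> (?A3 \<union> (?A4 \<union> (?A5 \<union> (?A6 \<union> (?A7 \<union> (?A8 \<union> (?A9 \<union> ?A10)))))))) = 9 * c + 6"
      by (subst card_Un_disjoint) (use k in \<open>auto simp: card inj simp del: add_Suc_right\<close>)
    then have "card (?A1 \<union> (?A2 \<union> (?A3 \<union> (?A4 \<union> (?A5 \<union> (?A6 \<union> (?A7 \<union> (?A8 \<union> (?A9 \<union> ?A10))))))))) = 10 * c + 7"
      by (subst card_Un_disjoint) (use k in \<open>auto simp: card inj simp del: add_Suc_right\<close>)
    then show ?thesis using k by simp
  qed
  finally show ?thesis .
qed

lemma finite_arc_pairs:
  assumes "2 \<le> k"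
  shows "finite {(x, y). \<exists>l. arc k x y l}"
  by (rule finite_subset[of _ "vertices k \<times> vertices k"])
    (use assms arc_in_vertices finite_vertices in \<open>auto\<close>)

lemma card_edges_arc:
  assumes "2 \<le> k"
  shows "card (edges (arc k)) = k * (2 * k + 9) - 3"
proof -
  let ?C = "{(x, y). (\<exists>l. arc k x y l) \<and> (\<exists>a b. x = H a \<and> y = H b)}"
  have pairs: "{(x, y). \<exists>l. arc k x y l} = ?C \<union> other_pairs k"
    by (auto simp: other_pairs_def)
  have fin: "finite ?C" "finite (other_pairs k)"
    using finite_arc_pairs[OF assms] unfolding pairs by simp_all
  have "card (edges (arc k)) = card {(x, y). \<exists>l. arc k x y l}"
    by (rule card_edges) (rule arc_asym)
  also have "\<dots> = card ?C + card (other_pairs k)"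
    unfolding pairs by (rule card_Un_disjoint[OF fin]) (auto simp: other_pairs_def)
  also have "\<dots> = k * (2 * k - 1) + (10 * k - 3)"
    using assms by (simp only: card_clique_pairs card_other_pairs)
  also have "\<dots> = k * (2 * k + 9) - 3"
    using assms by (simp add: algebra_simps diff_mult_distrib2)
  finally show ?thesis .
qed

text \<open>Pigeonhole against the number of edges outside the clique; the theorem removes 5n = 10k
  edges.\<close>

lemma ex_clique_edge:
  assumes "2 \<le> k" "F \<subseteq> edges (arc k)" "card F > 10 * k - 3"
  obtains a b where "{H a, H b} \<in> F" "a \<noteq> b" "a < 2 * k" "b < 2 * k"
proof -
  have "finite (other_pairs k)"
    by (rule finite_subset[OF _ finite_arc_pairs[OF assms(1)]]) (auto simp: other_pairs_def)
  moreover have "card ((\<lambda>(x, y). {x, y}) ` other_pairs k) \<le> 10 * k - 3"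
    using card_image_le[OF \<open>finite (other_pairs k)\<close>] card_other_pairs[OF assms(1)] by metis
  ultimately have "\<not> F \<subseteq> (\<lambda>(x, y). {x, y}) ` other_pairs k"
    using assms(3) by (meson card_mono finite_imageI le_trans not_less)
  then obtain e where e: "e \<in> F" "e \<notin> (\<lambda>(x, y). {x, y}) ` other_pairs k" by blast
  then obtain x y l where xy: "e = {x, y}" "arc k x y l" using assms(2) by (blast elim: edgesE)
  with e(2) obtain a b where "x = H a" "y = H b" unfolding other_pairs_def by blast
  with xy e(1) that[of a b] show ?thesis by simp
qed


subsection \<open>Every clique edge is needed\<close>

text \<open>\<open>tainted k i m x t\<close> over-approximates the vertices \<open>x\<close> that a journey from \<open>S i\<close>
  can reach at time \<open>t\<close> when the edge of path \<open>i\<close> entering position \<open>m\<close> is missing. The contacts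
  \<open>H i\<close>--\<open>U i\<close> and \<open>H (i + k)\<close>--\<open>W i\<close>, at the two ends of the time window of path \<open>i\<close>, leave only
  that path to go from \<open>S i\<close> to \<open>T i\<close>.\<close>

fun tainted :: "nat \<Rightarrow> nat \<Rightarrow> nat \<Rightarrow> vertex \<Rightarrow> nat \<Rightarrow> bool" where
  "tainted k i m (H x) t \<longleftrightarrow> x < 2 * k \<and> win k i \<le> t \<and> (t \<le> win k (Suc i) \<longrightarrow> path_pos k i x < m)"
| "tainted k i m (S j) t \<longleftrightarrow> j = i \<or> 4 * k \<le> t + 1 + 2 * min i j"
| "tainted k i m (T j) t \<longleftrightarrow> j \<noteq> i \<and> 4 * k \<le> t + 2 + 2 * j"
| "tainted k i m (U j) t \<longleftrightarrow> j = i \<or> win k j \<le> t"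
| "tainted k i m (W j) t \<longleftrightarrow> j \<noteq> i \<and> win k (Suc j) \<le> t"

text \<open>No taint is in the clique before window i opens, so a clique contact within this window
  belongs to path i and changes the position by one; only the missing edge leads from below m to
  m.\<close>

lemma tainted_step_HH:
  assumes t: "tainted k i m (H x) t" and i: "i < k"
    and adj: "adjacent (arc k) (H x) (H y) l" and less: "t < l"
    and removed: "path_index k x y = i \<Longrightarrow> Suc (path_pos k i x) = m \<Longrightarrow> path_pos k i y = m \<Longrightarrow> False"
  shows "tainted k i m (H y) l"
proof -
  from adj have xy: "x \<noteq> y" "x < 2 * k" "y < 2 * k" "l = clique_label k x y" by (simp_all add: adjacent_HH)
  have "path_pos k i y < m" if l: "l \<le> win k (Suc i)"
  proof -
    from xy obtain j p where j: "j = path_index k x y" "0 < p" "p < 2 * k" "l = win k j + p"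
      by (metis clique_labelE)
    have "win k i \<le> t" using t by simp
    then have "j = i"
      using l less j(2-4) win_gap[of j i k] win_gap[of i j k] by (cases i j rule: linorder_cases) (auto simp: win_Suc)
    moreover have "path_pos k i x < m" using t less l by simp
    ultimately show ?thesis
      using path_pos_path_index[OF xy(2,3,1) j(1)] removed j(1) by force
  qed
  then show ?thesis using t less xy by simp
qed

lemma tainted_step:
  assumes k: "2 \<le> k" and i: "i < k" and m: "0 < m" "m < 2 * k"
    and t: "tainted k i m x t" and adj: "adjacent (arc k) x y l" and less: "t < l"
    and removed: "\<And>c d. path_index k c d = i \<Longrightarrow> Suc (path_pos k i c) = m \<Longrightarrow> path_pos k i d = m \<Longrightarrow>
      c < 2 * k \<Longrightarrow> d < 2 * k \<Longrightarrow> x = H c \<Longrightarrow> y = H d \<Longrightarrow> False"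
  shows "tainted k i m y l"
proof -
  have win: "4 * k < win k k" "2 * k < win k i" "win k i < win k k" "win k (Suc i) \<le> win k k"
    using k i win_k_ge[of k] win_ge[of k i] win_gap[of i k k] win_mono[of "Suc i" k k] by simp_all
  have adj': "adjacent (arc k) y x l" using adj by (simp add: adjacent_sym)
  show ?thesis
  proof (cases x)
    case x: (H a)
    show ?thesis
    proof (cases y)
      case (H b)
      have "a < 2 * k" "b < 2 * k" using adj unfolding x H by (simp_all add: adjacent_HH)
      with tainted_step_HH[OF t[unfolded x] i adj[unfolded x H] less] removed[OF _ _ _ _ _ x H]
      show ?thesis unfolding H by blast
    next
      case (S j)
      then show ?thesis using t less win adjacent_S_cases[OF k adj'[unfolded S]] x by auto
    next
      case (T j)
      then show ?thesis using t less win adjacent_T_cases[OF k adj'[unfolded T]] x by auto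
    next
      case (U j)
      then show ?thesis using t less win adjacent_U_cases[OF adj'[unfolded U]] x win_mono[of j k k] by auto
    next
      \<comment> \<open>For j = i the contact takes place when the window closes, at
        \<open>H (i + k)\<close>, whose position 2k - 1 is not below m; so this vertex is still
        untainted.\<close>
      case (W j)
      with t less win adjacent_W_cases[OF adj'[unfolded W]] x
      have "j < k" "a = j + k" "l = win k (Suc j)" by auto
      then show ?thesis using t less m W x by (auto simp: win_Suc)
    qed
  next
    \<comment> \<open>The critical contact is that of the hub with \<open>T i\<close> at 4k - 2 -
      2i: the taint of \<open>S i\<close> gets to the hub one label later at the earliest.\<close>
    case (S j)
    then show ?thesis using t less win adjacent_S_cases[OF k adj[unfolded S]] i m by auto
  next
    case (T j)
    then show ?thesis using t less win adjacent_T_cases[OF k adj[unfolded T]] i win_mono[of "Suc j" k k]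
      by auto
  next
    \<comment> \<open>\<open>H j\<close> can be tainted from here only for j = i, as any other
      \<open>U j\<close> is untainted before \<open>win k j\<close>, the label of this contact; the
      start of path i has position 0 < m. \<open>H k\<close> is met only after all windows.\<close>
    case (U j)
    then show ?thesis using t less win adjacent_U_cases[OF adj[unfolded U]] i m k win_ge[of k j] by auto
  next
    case (W j)
    then show ?thesis using t less win adjacent_W_cases[OF adj[unfolded W]] win_ge[of k "Suc j"] by auto
  qed
qed

lemma no_journey_without_clique_edge:
  assumes k: "2 \<le> k" and proper: "proper_tg (edges (arc k)) (labels (arc k))"
    and ab: "a < 2 * k" "b < 2 * k" "a \<noteq> b" and F: "{H a, H b} \<in> F"
  shows "\<not> journey (edges (arc k) - F) (labels (arc k)) (S (path_index k a b)) (T (path_index k a b))"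
proof
  let ?i = "path_index k a b"
  let ?m = "max (path_pos k ?i a) (path_pos k ?i b)"
  have i: "?i < k" using ab by (rule path_index_less)
  then have m: "?m < 2 * k" using ab path_pos_less by simp
  have m0: "0 < ?m" using path_pos_path_index[OF ab refl] by auto
  assume "journey (edges (arc k) - F) (labels (arc k)) (S ?i) (T ?i)"
  moreover have "proper_tg (edges (arc k) - F) (labels (arc k))"
    using proper unfolding proper_tg_def by simp
  moreover have "0 < l" if "e \<in> edges (arc k) - F" "l \<in> labels (arc k) e" for e l
    using that(2) arc_bounds[OF k] unfolding labels_def by fastforce
  moreover have "tainted k ?i ?m (S ?i) 0" by simp
  moreover have "tainted k ?i ?m y l" if t: "tainted k ?i ?m x t" and e: "{x, y} \<in> edges (arc k) - F"
    and l: "l \<in> labels (arc k) {x, y}" and less: "t < l" for x y t l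
  proof (rule tainted_step[OF k i m0 m t _ less])
    show "adjacent (arc k) x y l" using l by (simp add: labels_iff)
    fix c d assume c: "Suc (path_pos k ?i c) = ?m" "path_pos k ?i d = ?m" "c < 2 * k" "d < 2 * k"
      and xy: "x = H c" "y = H d"
    have "c = a \<and> d = b \<or> c = b \<and> d = a"
    proof (cases "path_pos k ?i a < path_pos k ?i b")
      case True
      then have "path_pos k ?i c = path_pos k ?i a" "path_pos k ?i d = path_pos k ?i b"
        using path_pos_path_index[OF ab refl] c(1,2) by simp_all
      then show ?thesis using path_pos_inject[OF i] c(3,4) ab by metis
    next
      case False
      then have "path_pos k ?i c = path_pos k ?i b" "path_pos k ?i d = path_pos k ?i a"
        using path_pos_path_index[OF ab refl] c(1,2) by simp_all
      then show ?thesis using path_pos_inject[OF i] c(3,4) ab by metis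
    qed
    then have "{x, y} = {H a, H b}" using xy by auto
    then show False using e F by simp
  qed
  ultimately have "\<exists>t. tainted k ?i ?m (T ?i) t" by (rule journey_invariant)
  then show False by simp
qed


subsection \<open>Temporal connectivity\<close>

lemma adjacent_arc: "arc k x y l \<Longrightarrow> adjacent (arc k) x y l" "arc k x y l \<Longrightarrow> adjacent (arc k) y x l"
  by (simp_all add: adjacent_def)

abbreviation reaches :: "nat \<Rightarrow> vertex \<Rightarrow> vertex \<Rightarrow> nat \<Rightarrow> bool" where
  "reaches k \<equiv> reach_by (arc k)"

text \<open>The edge entering position q of path i has label \<open>win k i + q\<close>, so being at
  a position by its label is in time for the next edge. A path may be boarded at any vertex.\<close>

lemma reach_along_path:
  assumes i: "i < k" and x: "x < 2 * k" and u: "reaches k u (H x) (win k i + path_pos k i x)"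
    and y: "y < 2 * k" and le: "path_pos k i x \<le> path_pos k i y"
  shows "reaches k u (H y) (win k i + path_pos k i y)"
proof -
  have "\<forall>y<2 * k. path_pos k i y = q \<longrightarrow> reaches k u (H y) (win k i + q)" if "path_pos k i x \<le> q" for q
    using that
  proof (induction q rule: dec_induct)
    case base
    then show ?case using u path_pos_inject[OF i x] by metis
  next
    case (step q)
    show ?case
    proof (intro allI impI)
      fix y assume y: "y < 2 * k" "path_pos k i y = Suc q"
      then have "q < 2 * k" using path_pos_less[OF i, of y] by simp
      then obtain z where z: "z < 2 * k" "path_pos k i z = q" by (rule path_pos_surj[OF i])
      have "path_index k z y = i" using path_index_eqI[OF z(1) y(1) i] y z by simp
      moreover have "z \<noteq> y" using y z by auto
      ultimately have "adjacent (arc k) (H z) (H y) (win k i + Suc q)"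
        using y z by (simp add: adjacent_HH clique_label_def)
      with step.IH z show "reaches k u (H y) (win k i + Suc q)"
        by (auto intro: reach_by_step)
    qed
  qed
  then show ?thesis using y le by blast
qed

text \<open>Path j visits every clique vertex, so from anywhere in the clique at the opening of
  window j it can be followed to its end and left through \<open>W j\<close>.\<close>

lemma reach_via_window:
  assumes k: "2 \<le> k" and j: "j < k" and x: "x < 2 * k" and u: "reaches k u (H x) (win k j)"
  shows "reaches k u (W j) (win k (Suc j))" "reaches k u (T j) (win k k + 2 * k)"
proof -
  have "reaches k u (H x) (win k j + path_pos k j x)"
    using u by (rule reach_by_mono) simp
  then have "reaches k u (H (j + k)) (win k j + path_pos k j (j + k))"
    by (rule reach_along_path[OF j x]) (use j x path_pos_less[OF j x] in simp_all)
  then have "reaches k u (H (j + k)) (win k (Suc j))"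
    by (rule reach_by_mono) (use j in \<open>simp add: win_Suc\<close>)
  then show W: "reaches k u (W j) (win k (Suc j))"
    by (rule reach_by_step[OF _ adjacent_arc(1)]) (use j in simp_all)
  show "reaches k u (T j) (win k k + 2 * k)"
    by (rule reach_by_step[OF W adjacent_arc(2)]) (use j win_mono[of "Suc j" k k] in simp_all)
qed

lemma reach_S_U:
  assumes k: "2 \<le> k" and u: "reaches k u (H k) (win k k)" and j: "j < k"
  shows "reaches k u (S j) (win k k + 2 * k)" "reaches k u (U j) (win k k + 2 * k)"
proof -
  have "reaches k u (S j) (win k k + 1 + j)"
    by (rule reach_by_step[OF u adjacent_arc(1)]) (use j in simp_all)
  then show "reaches k u (S j) (win k k + 2 * k)" by (rule reach_by_mono) (use j in simp)
  have "reaches k u (U j) (win k k + 1 + k + j)"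
    by (rule reach_by_step[OF u adjacent_arc(1)]) (use j in simp_all)
  then show "reaches k u (U j) (win k k + 2 * k)" by (rule reach_by_mono) (use j in simp)
qed

text \<open>Path 0 ends in \<open>H k\<close>, which is what makes this vertex the late hub. Clique
  targets are left out, since those before x on path 0 are missed.\<close>

lemma reach_all_but_H:
  assumes k: "2 \<le> k" and x: "x < 2 * k" and u: "reaches k u (H x) (win k 0)"
    and v: "v \<in> vertices k" "v \<notin> range H"
  shows "\<exists>c. reaches k u v c"
proof -
  have u': "reaches k u (H x) (win k j)" for j using u by (rule reach_by_mono) (simp add: win_mono)
  have "reaches k u (H x) (win k 0 + path_pos k 0 x)" using u by (rule reach_by_mono) simp
  then have "reaches k u (H k) (win k 0 + path_pos k 0 k)"
    by (rule reach_along_path[rotated 2])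
      (use k x path_pos_less[of 0 k x] path_pos_end[of 0 k] in simp_all)
  moreover have "win k 0 + path_pos k 0 k \<le> win k k"
    using k path_pos_less[of 0 k k] win_gap[of 0 k k] by simp
  ultimately have "reaches k u (H k) (win k k)" by (rule reach_by_mono)
  from reach_S_U[OF k this] reach_via_window[OF k _ x u'] v show ?thesis
    unfolding vertices_def by blast
qed

text \<open>\<open>H 0\<close> is the early hub because it is the start of path 0, which then sweeps
  the whole clique.\<close>

lemma reach_all_from_start:
  assumes k: "2 \<le> k" and u: "reaches k u (H 0) (win k 0)" and v: "v \<in> vertices k"
  shows "\<exists>c. reaches k u v c"
proof (cases "v \<in> range H")
  case True
  then obtain y where y: "v = H y" "y < 2 * k" using v by (auto simp: vertices_def)
  have "reaches k u (H y) (win k 0 + path_pos k 0 y)"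
    by (rule reach_along_path[of 0 k 0]) (use k u y in simp_all)
  then show ?thesis using y by blast
next
  case False
  then show ?thesis using reach_all_but_H[OF k _ u v] k by simp
qed

text \<open>After their contact at label 1, \<open>S i\<close> and \<open>U i\<close> share their
  information, so one argument covers both as sources. \<open>T j\<close> and \<open>W j\<close> are
  served by path j if i \<le> j, and through the third hub otherwise.\<close>

lemma reach_all_from_S_U:
  assumes k: "2 \<le> k" and i: "i < k" and u: "reaches k u (S i) 1" "reaches k u (U i) 1"
    and v: "v \<in> vertices k"
  shows "\<exists>c. reaches k u v c"
proof -
  have uHi: "reaches k u (H i) (win k i)"
    by (rule reach_by_step[OF u(2) adjacent_arc(2)]) (use i in \<open>simp_all add: win_def\<close>)
  have uH: "reaches k u (H y) (win k i + path_pos k i y)" if "y < 2 * k" for y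
    using reach_along_path[OF i, of i u y] uHi i that by simp
  have "win k i + path_pos k i k \<le> win k k"
    using k path_pos_less[OF i, of k] win_gap[OF i, of k] by simp
  then have "reaches k u (H k) (win k k)" by (rule reach_by_mono[OF uH, rotated]) (use k in simp)
  note SU = reach_S_U[OF k this]
  have TW: "\<exists>c. reaches k u (T j) c" "\<exists>c. reaches k u (W j) c" if j: "j < k" for j
  proof -
    have "(\<exists>c. reaches k u (T j) c) \<and> (\<exists>c. reaches k u (W j) c)"
    proof (cases "i \<le> j")
      case True
      then have "reaches k u (H i) (win k j)"
        by (intro reach_by_mono[OF uHi] win_mono)
      moreover have "i < 2 * k" using i by simp
      ultimately show ?thesis using reach_via_window[OF k j] by blast
    next
      case False
      \<comment> \<open>This is in time for \<open>T j\<close>: 4k - 1 - 2i \<le> 4k - 2 - 2j means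
        j < i.\<close>
      have c: "reaches k u (S (k - 1)) (4 * k - 1 - 2 * i)"
      proof (cases "i = k - 1")
        case True
        then show ?thesis using reach_by_mono[OF u(1)] k by simp
      next
        case ne: False
        show ?thesis
          by (rule reach_by_step[OF u(1) adjacent_arc(1)]) (use False ne i in simp_all)
      qed
      have T: "reaches k u (T j) (4 * k - 2 - 2 * j)"
        by (rule reach_by_step[OF c adjacent_arc(1)]) (use False i in simp_all)
      have "reaches k u (W j) (win k k + 2 * k)"
        by (rule reach_by_step[OF T adjacent_arc(1)]) (use j win_k_ge[of k] in simp_all)
      with T show ?thesis by blast
    qed
    then show "\<exists>c. reaches k u (T j) c" "\<exists>c. reaches k u (W j) c" by simp_all
  qed
  show ?thesis
  proof (cases v)
    case (H y)
    then have "y < 2 * k" using v by (auto simp: vertices_def)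
    from uH[OF this] show ?thesis unfolding H ..
  next
    case (S j)
    then have "j < k" using v by (auto simp: vertices_def)
    from SU(1)[OF this] show ?thesis unfolding S ..
  next
    case (T j)
    then have "j < k" using v by (auto simp: vertices_def)
    from TW(1)[OF this] show ?thesis unfolding T .
  next
    case (U j)
    then have "j < k" using v by (auto simp: vertices_def)
    from SU(2)[OF this] show ?thesis unfolding U ..
  next
    case (W j)
    then have "j < k" using v by (auto simp: vertices_def)
    from TW(2)[OF this] show ?thesis unfolding W .
  qed
qed

lemma temporally_connected_arc:
  assumes k: "2 \<le> k"
  shows "temporally_connected (vertices k) (edges (arc k)) (labels (arc k))"
  unfolding temporally_connected_def
proof (intro ballI impI)
  fix u v assume u: "u \<in> vertices k" and v: "v \<in> vertices k" and ne: "u \<noteq> v"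
  have direct: "reaches k u w l" if "adjacent (arc k) u w l" for w l
    by (rule reach_by_step[OF reach_by_refl[of _ u 0] that]) simp
  \<comment> \<open>For \<open>T i\<close> and \<open>W i\<close>, which meet \<open>H 0\<close>
    before window 0 opens at 2k + 1.\<close>
  have start: "\<exists>c. reaches k u v c" if "adjacent (arc k) u (H 0) l" "l \<le> 2 * k" for l
  proof (rule reach_all_from_start[OF k _ v])
    show "reaches k u (H 0) (win k 0)"
      by (rule reach_by_mono[OF direct[OF that(1)]]) (use that(2) in \<open>simp add: win_0\<close>)
  qed
  have "\<exists>c. reaches k u v c"
  proof (cases u)
    case (H x)
    then have x: "x < 2 * k" using u by (auto simp: vertices_def)
    show ?thesis
    proof (cases "v \<in> range H")
      case True
      then obtain y where "v = H y" "y < 2 * k" using v by (auto simp: vertices_def)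
      then have "adjacent (arc k) u v (clique_label k x y)" using H x ne by (simp add: adjacent_HH)
      from direct[OF this] show ?thesis ..
    next
      case False
      show ?thesis by (rule reach_all_but_H[OF k x _ v False]) (simp add: H reach_by_refl)
    qed
  next
    case (S i)
    then have i: "i < k" using u by (auto simp: vertices_def)
    then have "adjacent (arc k) u (U i) 1" using S by (simp add: adjacent_def)
    from direct[OF this] show ?thesis
      by (rule reach_all_from_S_U[OF k i _ _ v, rotated]) (simp add: S reach_by_refl)
  next
    case (U i)
    then have i: "i < k" using u by (auto simp: vertices_def)
    then have "adjacent (arc k) u (S i) 1" using U by (simp add: adjacent_def)
    from direct[OF this] show ?thesis
      by (rule reach_all_from_S_U[OF k i _ _ v]) (simp add: U reach_by_refl)
  next
    case (T i)
    then have "i < k" using u by (auto simp: vertices_def)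
    then show ?thesis by (intro start[of "i + 1"]) (simp_all add: T adjacent_def)
  next
    case (W i)
    then have "i < k" using u by (auto simp: vertices_def)
    then show ?thesis by (intro start[of "k + i + 1"]) (simp_all add: W adjacent_def)
  qed
  then show "journey (edges (arc k)) (labels (arc k)) u v" by (elim exE) (rule reach_by_imp_journey[OF _ ne])
qed

lemma fragile_graph_arc:
  assumes k: "2 \<le> k"
  shows "fragile_graph (6 * k) (k * (2 * k + 9) - 3) (win k k + 2 * k) (10 * k)
    (vertices k) (edges (arc k)) (labels (arc k))"
proof -
  have happy: "happy_tg (edges (arc k)) (labels (arc k))"
    by (rule happy_edges[OF adjacent_functional[OF k] adjacent_inject[OF k]])
  have "\<not> temporally_connected (vertices k) (edges (arc k) - F) (labels (arc k))"
    if F: "F \<subseteq> edges (arc k)" "card F = 10 * k" for F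
  proof
    assume conn: "temporally_connected (vertices k) (edges (arc k) - F) (labels (arc k))"
    have "10 * k - 3 < card F" using F(2) k by simp
    then obtain a b where ab: "{H a, H b} \<in> F" "a \<noteq> b" "a < 2 * k" "b < 2 * k"
      by (rule ex_clique_edge[OF k F(1)])
    have "proper_tg (edges (arc k)) (labels (arc k))" using happy by (simp add: happy_tg_def)
    note no_journey_without_clique_edge[OF k this ab(3,4,2,1)]
    moreover have "path_index k a b < k" using ab(3,4,2) by (rule path_index_less)
    then have "S (path_index k a b) \<in> vertices k" "T (path_index k a b) \<in> vertices k"
      by (simp_all add: vertices_def)
    ultimately show False using conn unfolding temporally_connected_def by blast
  qed
  moreover have "labels (arc k) e \<subseteq> {1..win k k + 2 * k}" for e
    using arc_bounds[OF k] unfolding labels_def by auto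
  moreover have "temporal_graph (vertices k) (edges (arc k)) (labels (arc k))"
    by (rule temporal_graph_edges[OF finite_vertices]) (rule arc_in_vertices[OF k])
  ultimately show ?thesis
    unfolding fragile_graph_def
    using happy card_vertices card_edges_arc[OF k] temporally_connected_arc[OF k] by simp
qed


section \<open>The case of six vertices\<close>

text \<open>For \<open>n = 2\<close> the construction would have one edge too many; there the fragility requirement is
  void, and the usual gossip scheme on a 4-cycle with two pendant vertices, each contacted twice, does.\<close>

fun spread :: "('a \<times> 'a \<times> nat) list \<Rightarrow> 'a set \<Rightarrow> 'a set" where
  "spread [] X = X"
| "spread ((x, y, l) # cs) X = spread cs (if x \<in> X \<or> y \<in> X then insert x (insert y X) else X)"

text \<open>\<open>X\<close> holds vertices reached by time t. Contacts of equal label may be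
  processed one after the other, because \<open>reach_by\<close> asks only for weakly increasing
  labels.\<close>

lemma reach_by_spread:
  assumes "sorted (map (snd \<circ> snd) cs)" "\<forall>(x, y, l) \<in> set cs. A x y l \<and> t \<le> l"
    and "\<forall>x\<in>X. reach_by A u x t" "v \<in> spread cs X"
  shows "\<exists>t. reach_by A u v t"
  using assms
proof (induction cs X arbitrary: t rule: spread.induct)
  case (2 x y l cs X)
  have adj: "adjacent A x y l" "adjacent A y x l" and "t \<le> l"
    using "2.prems"(2) by (auto simp: adjacent_def)
  have "reach_by A u z l" if "z \<in> (if x \<in> X \<or> y \<in> X then insert x (insert y X) else X)" for z
    using that "2.prems"(3) \<open>t \<le> l\<close> adj reach_by_mono[of A u _ t l] reach_by_step[of A u _ t]
    by (auto split: if_splits)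
  moreover have "\<forall>(x, y, l') \<in> set cs. A x y l' \<and> l \<le> l'"
    using "2.prems"(1,2) by auto
  ultimately show ?case
    using "2.IH"[of l] "2.prems"(1,4) by simp
qed auto

text \<open>Vertices 4 and 5 hand in their information at 0 and 1 and collect everything at 2 and 3:
  different cycle vertices, because an edge carries a single label.\<close>

definition gossip :: "(nat \<times> nat \<times> nat) list" where
  "gossip = [(0, 4, 1), (1, 5, 1), (0, 1, 2), (2, 3, 2), (0, 2, 3), (1, 3, 3), (2, 4, 4), (3, 5, 4)]"

lemma fragile_graph_gossip: "\<exists>E lam. fragile_graph 6 8 6 10 {..<6 :: nat} E lam"
proof -
  define A where "A = (\<lambda>x y l. (x, y, l) \<in> set gossip)"
  have pairs: "{(x, y). \<exists>l. A x y l} =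
      {(0, 4), (1, 5), (0, 1), (2, 3), (0, 2), (1, 3), (2, 4), (3, 5)}"
    by (auto simp: A_def gossip_def)
  have "card (edges A) = card {(x, y). \<exists>l. A x y l}"
    by (rule card_edges) (auto simp: A_def gossip_def)
  then have card: "card (edges A) = 8" by (simp add: pairs)
  then have "finite (edges A)" using card.infinite by fastforce
  then have no_large: "card F \<noteq> 10" if "F \<subseteq> edges A" for F
    using card_mono[OF _ that] card by simp
  have conn: "journey (edges A) (labels A) u v" if "u < 6" "v < 6" "u \<noteq> v" for u v
  proof -
    have "u \<in> {0, 1, 2, 3, 4, 5}" using that(1) by auto
    then have "{0, 1, 2, 3, 4, 5} \<subseteq> spread gossip {u}"
      by (elim insertE) (simp_all add: gossip_def)
    moreover have "v \<in> {0, 1, 2, 3, 4, 5}" using that(2) by auto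
    ultimately have "v \<in> spread gossip {u}" by blast
    then have "\<exists>t. reach_by A u v t"
    proof (rule reach_by_spread[rotated 3])
      show "sorted (map (snd \<circ> snd) gossip)" by (simp add: gossip_def)
      show "\<forall>(x, y, l) \<in> set gossip. A x y l \<and> 0 \<le> l" by (auto simp: A_def)
      show "\<forall>x\<in>{u}. reach_by A u x 0" by (simp add: reach_by_refl)
    qed
    then obtain t where "reach_by A u v t" ..
    then show ?thesis using that(3) by (rule reach_by_imp_journey)
  qed
  have "happy_tg (edges A) (labels A)"
    by (rule happy_edges) (auto simp: A_def gossip_def adjacent_def)
  moreover have "temporal_graph {..<6} (edges A) (labels A)"
    by (rule temporal_graph_edges) (auto simp: A_def gossip_def)
  moreover have "labels A e \<subseteq> {1..6}" for e
    by (auto simp: labels_def A_def gossip_def)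
  ultimately show ?thesis
    unfolding fragile_graph_def temporally_connected_def using card conn no_large
    by (intro exI[of _ "edges A"] exI[of _ "labels A"]) simp
qed

section \<open>Transport to natural numbers and conclusion\<close>

fun vertex_code :: "vertex \<Rightarrow> nat" where
  "vertex_code (H i) = 5 * i"
| "vertex_code (S i) = 5 * i + 1"
| "vertex_code (T i) = 5 * i + 2"
| "vertex_code (U i) = 5 * i + 3"
| "vertex_code (W i) = 5 * i + 4"

lemma inj_vertex_code: "inj vertex_code"
proof (rule injI)
  fix x y assume "vertex_code x = vertex_code y"
  then show "x = y" by (cases x; cases y; simp; presburger)
qed

theorem mainTheorem16:
  fixes n :: nat
  assumes "even n" and "n \<ge> 2"
  shows "\<exists>(V :: nat set) E lam.
           temporal_graph V E lam \<and> happy_tg E lam \<and>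
           card V = 3 * n \<and>
           card E = n * (n + 9) div 2 - 3 \<and>
           (\<forall>e\<in>E. lam e \<subseteq> {1 .. n * (n + 5) div 2 - 1}) \<and>
           temporally_connected V E lam \<and>
           (\<forall>F \<subseteq> E. card F = 5 * n \<longrightarrow> \<not> temporally_connected V (E - F) lam)"
proof -
  obtain k where k: "n = 2 * k" using assms(1) by (rule evenE)
  have "\<exists>(V :: nat set) E lam.
    fragile_graph (3 * n) (n * (n + 9) div 2 - 3) (n * (n + 5) div 2 - 1) (5 * n) V E lam"
  proof (cases "k = 1")
    case True
    then show ?thesis using fragile_graph_gossip k by auto
  next
    case False
    then have k2: "2 \<le> k" using assms(2) k by simp
    \<comment> \<open>The two sides are 2k^2 + 4k + 1 and 2k^2 + 5k - 1, equal for k = 2.\<close>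
    have t: "win k k + 2 * k \<le> n * (n + 5) div 2 - 1"
      using k2 by (simp add: k win_def algebra_simps)
    have eqs: "3 * n = 6 * k" "n * (n + 9) div 2 - 3 = k * (2 * k + 9) - 3" "5 * n = 10 * k"
      by (simp_all add: k)
    have "fragile_graph (3 * n) (n * (n + 9) div 2 - 3) (n * (n + 5) div 2 - 1) (5 * n)
        (vertices k) (edges (arc k)) (labels (arc k))"
      using fragile_graph_arc[OF k2] t unfolding eqs fragile_graph_def by force
    then show ?thesis by (blast intro: fragile_graph_image[OF inj_vertex_code])
  qed
  then show ?thesis unfolding fragile_graph_def .
qed

end
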